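(* Let $\mathcal{I}$ be a finite index set partitioned into disjoint groups $\mathcal{I}_1,\dots,\mathcal{I}_K$. For each $k\in\{1,\dots,K\}$ let $p_k\in[-\infty,1)$ and let weights $w^k=(w_i)_{i\in\mathcal{I}_k}$ be given with $w_i>0$ and $\sum_{i\in\mathcal{I}_k}w_i=1$. Let $A=(A_i)_{i\in\mathcal{I}}$ be a tuple of nonzero real symmetric positive semidefinite $n\times n$ matrices, and let $B$ be a real symmetric positive semidefinite $n\times n$ matrix. Put $q_k=p_k(p_k-1)^{-1}$ (with $q_k=1$ if $p_k=-\infty$), and define $\mathcal{A}=\prod_{k=1}^K\mathcal{A}_k$, where $$\mathcal{A}_k=\Bigl\{\alpha\in\mathbb{R}_{\ge 0}^{|\mathcal{I}_k|}\;\Bigm|\;\operatorname{Mean}_{q_k,w^k}[\alpha]=1\Bigr\}\ \text{ if } p_k<0,\qquad \mathcal{A}_k=\Bigl\{\alpha\in\mathbb{R}_{>0}^{|\mathcal{I}_k|}\;\Bigm|\;\operatorname{Mean}_{q_k,w^k}[\alpha]=1\Bigr\}\ \text{ if } 0\le p_k<1.$$ Consider the statements: (i) For all $x\in\mathbb{R}^n$, $\displaystyle\sum_{k=1}^K\operatorname{Mean}_{p_k,w^k}\bigl[(x^\top A_i x)_{i\in\mathcal{I}_k}\bigr]\le x^\top Bx$. (ii) There exists $\alpha\in\mathcal{A}$ such that $\displaystyle\sum_{i\in\mathcal{I}}\alpha_i w_i A_i\preceq B$. Then the implication (ii) $\Rightarrow$ (i) always holds; and if the lower envelope $V_{A,B}$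 is convex, then (i) $\Leftrightarrow$ (ii).
   Context: Weighted power means: for $y\in\mathbb{R}^m_{\ge 0}$, weights $w\in\mathbb{R}^m_{>0}$ with $\sum_i w_i=1$, and real $p\ne 0$, $\operatorname{Mean}_{p,w}[y]=\bigl(\sum_{i=1}^m w_i y_i^p\bigr)^{1/p}$, with the convention that $\operatorname{Mean}_{p,w}[y]=0$ if $p<0$ and some $y_i=0$. In the limiting cases, $\operatorname{Mean}_{0,w}[y]=\prod_{i=1}^m y_i^{w_i}$, $\operatorname{Mean}_{-\infty,w}[y]=\min_i y_i$ and $\operatorname{Mean}_{+\infty,w}[y]=\max_i y_i$. Lower envelope: for a tuple $A=(A_i)_{i\in\mathcal{I}}$ of real symmetric $n\times n$ matrices and a symmetric positive semidefinite $n\times n$ matrix $B$, $V_{A,B}:\mathbb{R}^{|\mathcal{I}|}\to\mathbb{R}\cup\{+\infty\}$ is defined by $$V_{A,B}(a)=\inf\bigl\{x^\top Bx\;\big|\;x\in\mathbb{R}^n,\ x^\top A_i x=a_i\ \text{for all } i\in\mathcal{I}\bigr\},\qquad \inf\varnothing=+\infty.$$ Convexity of $V_{A,B}$ is meant in the extended-real-valued sense. $\preceq$ denotes the Loewner order on symmetric matrices. *)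

theory Defs
  imports "HOL-Analysis.Analysis"
begin

definition quad_form :: "real^'n^'n \<Rightarrow> real^'n \<Rightarrow> real" where
  "quad_form M x = x \<bullet> (M *v x)"

definition psd :: "real^'n^'n \<Rightarrow> bool" where
  "psd M \<longleftrightarrow> transpose M = M \<and> (\<forall>x. 0 \<le> quad_form M x)"

definition loewner_le :: "real^'n^'n \<Rightarrow> real^'n^'n \<Rightarrow> bool"  (infix \<open>\<preceq>\<close> 50) where
  "M \<preceq> N \<longleftrightarrow> psd (N - M)"

text \<open>
  Weighted power mean of \<open>(y i)\<close> for \<open>i \<in> J\<close>, meant for a finite nonempty \<open>J\<close>, nonnegative \<open>y\<close> and
  positive weights summing to \<open>1\<close> over \<open>J\<close>. The exponent is extended-real. As
  \<open>0 powr a = 0\<close> for every \<open>a\<close>, the convention for negative exponents has to be written out;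
  for positive exponents \<open>0 powr r = 0\<close> is the usual value.
\<close>

definition power_mean :: "ereal \<Rightarrow> 'i set \<Rightarrow> ('i \<Rightarrow> real) \<Rightarrow> ('i \<Rightarrow> real) \<Rightarrow> real" where
  "power_mean p J w y =
    (case p of
       MInfty \<Rightarrow> Min (y ` J)
     | PInfty \<Rightarrow> Max (y ` J)
     | ereal r \<Rightarrow>
         if r = 0 then \<Prod>i\<in>J. y i powr w i
         else if r < 0 \<and> (\<exists>i\<in>J. y i = 0) then 0
         else (\<Sum>i\<in>J. w i * y i powr r) powr (1 / r))"

definition dual_exponent :: "ereal \<Rightarrow> ereal" where
  "dual_exponent p = (if p = -\<infinity> then 1 else p / (p - 1))"

text \<open>
  Membership depends only on the values of \<open>\<alpha>\<close> on \<open>J\<close>, so that the product of these sets over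
  the groups of a partition is an intersection.
\<close>

definition multiplier_set :: "ereal \<Rightarrow> 'i set \<Rightarrow> ('i \<Rightarrow> real) \<Rightarrow> ('i \<Rightarrow> real) set" where
  "multiplier_set p J w =
    {\<alpha>. (\<forall>i\<in>J. if p < 0 then 0 \<le> \<alpha> i else 0 < \<alpha> i) \<and> power_mean (dual_exponent p) J w \<alpha> = 1}"

text \<open>The infimum is taken in \<^typ>\<open>ereal\<close>, where the infimum of the empty set is \<open>\<infinity>\<close>.\<close>

definition lower_envelope ::
    "('i::finite \<Rightarrow> real^'n^'n) \<Rightarrow> real^'n^'n \<Rightarrow> real^'i \<Rightarrow> ereal" where
  "lower_envelope A B a = (INF x\<in>{x. \<forall>i. quad_form (A i) x = a $ i}. ereal (quad_form B x))"

text \<open>Convexity of a function with values in the reals extended by \<open>\<infinity>\<close>.\<close>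

definition ereal_convex :: "('a::real_vector \<Rightarrow> ereal) \<Rightarrow> bool" where
  "ereal_convex f \<longleftrightarrow>
    (\<forall>a b. \<forall>t::real. 0 < t \<and> t < 1 \<longrightarrow>
       f ((1 - t) *\<^sub>R a + t *\<^sub>R b) \<le> ereal (1 - t) * f a + ereal t * f b)"

end

theory Submission
  imports Defs
begin

text \<open>
  For $p < 1$ with dual exponent $q = p/(p-1)$, the reverse Hoelder inequality says
  $\mathrm{Mean}_p[y] \le \sum_i w_i \alpha_i y_i$ whenever $\mathrm{Mean}_q[\alpha] = 1$, with equality
  for a suitable $\alpha$ if $y > 0$. Summing over the groups gives (ii) $\Rightarrow$ (i), and it
  exhibits the left-hand side $F$ of (i) as an infimum of linear functions, hence concave on the open
  positive orthant. Under (i) the strict hypograph of $F$ is disjoint from the epigraph of the convex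
  function $V_{A,B}$. The separating hyperplane is not vertical, because some $x$ has
  $x^\top A_i x > 0$ for all $i$, so it is the graph of a linear function $l$ with
  $F \le l \le V_{A,B}$. Testing $l$ on one group at a time shows that its coefficients $\alpha_i w_i$
  satisfy $\mathrm{Mean}_{q_k}[\alpha] \ge 1$ on each group, and scaling $\alpha$ down on each
  group gives (ii).
\<close>

section \<open>Weighted power means and duality\<close>

text \<open>Serves to discard an error term linear in \<open>e\<close>, of either sign, after a
  perturbation by \<open>e > 0\<close> was used to satisfy strict inequalities.\<close>

lemma le_if_le_add_mult:
  fixes c x y :: real
  assumes "\<And>e. 0 < e \<Longrightarrow> c \<le> x + e * y"
  shows "c \<le> x"
proof -
  have "((\<lambda>e. x + e * y) \<longlongrightarrow> x + 0 * y) (at_right 0)"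
    by (intro tendsto_intros)
  moreover have "\<forall>\<^sub>F e in at_right 0. c \<le> x + e * y"
    using assms by (simp add: eventually_at_right_less eventually_at_filter)
  ultimately show ?thesis
    using tendsto_lowerbound by fastforce
qed

section \<open>Weighted mean inequalities for finite sums\<close>

lemma powr_eq_one_imp:
  fixes a x :: real
  assumes "x \<noteq> 0" "0 \<le> a" "a powr x = 1"
  shows "a = 1"
  using assms powr_eq_one_iff_gen[of a x] by (cases "a = 0") auto

text \<open>Jensen's inequality for the concave \<open>ln\<close>, exponentiated; a zero entry makes
  the product vanish and is treated apart.\<close>

lemma weighted_arith_geom_mean:
  fixes w y :: "'i \<Rightarrow> real"
  assumes "finite J" and w: "\<And>i. i \<in> J \<Longrightarrow> 0 < w i" and "sum w J = 1"
    and y: "\<And>i. i \<in> J \<Longrightarrow> 0 \<le> y i"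
  shows "(\<Prod>i\<in>J. y i powr w i) \<le> (\<Sum>i\<in>J. w i * y i)"
proof (cases "\<exists>i\<in>J. y i = 0")
  case True
  then have "(\<Prod>i\<in>J. y i powr w i) = 0"
    using \<open>finite J\<close> by (auto simp: prod_zero_iff)
  then show ?thesis
    using w y by (simp add: less_imp_le sum_nonneg)
next
  case False
  then have pos: "0 < y i" if "i \<in> J" for i
    using y[OF that] that by force
  have "J \<noteq> {}"
    using \<open>sum w J = 1\<close> by auto
  have "(\<Sum>i\<in>J. w i * ln (y i)) \<le> ln (\<Sum>i\<in>J. w i *\<^sub>R y i)"
    using assms \<open>J \<noteq> {}\<close> pos
    by (intro concave_on_sum[OF _ _ ln_concave]) (auto simp: less_imp_le)
  moreover have "0 < (\<Sum>i\<in>J. w i *\<^sub>R y i)"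
    using \<open>finite J\<close> \<open>J \<noteq> {}\<close> w pos by (simp add: sum_pos)
  ultimately have "exp (\<Sum>i\<in>J. w i * ln (y i)) \<le> (\<Sum>i\<in>J. w i *\<^sub>R y i)"
    by (simp add: ln_ge_iff)
  moreover have "exp (\<Sum>i\<in>J. w i * ln (y i)) = (\<Prod>i\<in>J. y i powr w i)"
    unfolding exp_sum[OF \<open>finite J\<close>] using pos
    by (intro prod.cong) (force simp: powr_def)+
  ultimately show ?thesis by simp
qed

text \<open>Divide \<open>u\<close> and \<open>v\<close> by their weighted sums \<open>U\<close> and
  \<open>V\<close>, apply Young's inequality at each index and sum: the right-hand sides add up to
  \<theta> + (1 - \<theta>) = 1. Splitting the exponents as \<theta> and 1 - \<theta> lets the same
  inequality serve both \<open>0 < r\<close> and \<open>r < 0\<close> later.\<close>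

lemma weighted_Holder:
  fixes w u v :: "'i \<Rightarrow> real"
  assumes "finite J" and w: "\<And>i. i \<in> J \<Longrightarrow> 0 < w i"
    and u: "\<And>i. i \<in> J \<Longrightarrow> 0 \<le> u i" and v: "\<And>i. i \<in> J \<Longrightarrow> 0 \<le> v i"
    and \<theta>: "0 < \<theta>" "\<theta> < 1"
  shows "(\<Sum>i\<in>J. w i * (u i powr \<theta> * v i powr (1 - \<theta>)))
      \<le> (\<Sum>i\<in>J. w i * u i) powr \<theta> * (\<Sum>i\<in>J. w i * v i) powr (1 - \<theta>)"
proof -
  define U V where "U = (\<Sum>i\<in>J. w i * u i)" and "V = (\<Sum>i\<in>J. w i * v i)"
  have nn: "0 \<le> w i * u i" "0 \<le> w i * v i" if "i \<in> J" for i
    using w[OF that] u[OF that] v[OF that] by auto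
  have "0 \<le> U" "0 \<le> V"
    unfolding U_def V_def by (auto intro!: sum_nonneg nn)
  show ?thesis
  proof (cases "U = 0 \<or> V = 0")
    case True
    \<comment> \<open>A vanishing sum of nonnegative terms forces one factor to be 0 at every index,
      so the left-hand side is 0 because \<open>0 powr a = 0\<close>.\<close>
    have "u i = 0 \<or> v i = 0" if "i \<in> J" for i
    proof -
      have "w i * u i = 0 \<or> w i * v i = 0"
        using True nn sum_nonneg_eq_0_iff[of J "\<lambda>i. w i * u i"]
          sum_nonneg_eq_0_iff[of J "\<lambda>i. w i * v i"] \<open>finite J\<close> that
        unfolding U_def V_def by blast
      then show ?thesis
        using w[OF that] by auto
    qed
    then have "(\<Sum>i\<in>J. w i * (u i powr \<theta> * v i powr (1 - \<theta>))) = 0"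
      by (intro sum.neutral) auto
    then show ?thesis
      by simp
  next
    case False
    then have "0 < U" "0 < V"
      using \<open>0 \<le> U\<close> \<open>0 \<le> V\<close> by auto
    have "u i powr \<theta> * v i powr (1 - \<theta>) / (U powr \<theta> * V powr (1 - \<theta>))
        \<le> \<theta> * (u i / U) + (1 - \<theta>) * (v i / V)" if "i \<in> J" for i
    proof (cases "u i = 0 \<or> v i = 0")
      case True
      then show ?thesis
        using \<theta> u[OF that] v[OF that] \<open>0 < U\<close> \<open>0 < V\<close> by auto
    next
      case False
      then have "0 < u i" "0 < v i"
        using u[OF that] v[OF that] by auto
      then show ?thesis
        using Youngs_inequality_0[of \<theta> "1 - \<theta>" "u i / U" "v i / V"] \<theta> \<open>0 < U\<close> \<open>0 < V\<close>
        by (simp add: powr_divide)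
    qed
    then have "(\<Sum>i\<in>J. w i * (u i powr \<theta> * v i powr (1 - \<theta>) / (U powr \<theta> * V powr (1 - \<theta>))))
        \<le> (\<Sum>i\<in>J. w i * (\<theta> * (u i / U) + (1 - \<theta>) * (v i / V)))"
      using w by (intro sum_mono mult_left_mono) (auto simp: less_imp_le)
    also have "\<dots> = \<theta> * ((\<Sum>i\<in>J. w i * u i) / U) + (1 - \<theta>) * ((\<Sum>i\<in>J. w i * v i) / V)"
      unfolding sum_divide_distrib sum_distrib_left sum.distrib[symmetric]
      by (intro sum.cong) (auto simp: algebra_simps)
    also have "\<dots> = 1"
      using \<open>0 < U\<close> \<open>0 < V\<close> by (simp flip: U_def V_def)
    finally have "(\<Sum>i\<in>J. w i * (u i powr \<theta> * v i powr (1 - \<theta>))) / (U powr \<theta> * V powr (1 - \<theta>)) \<le> 1"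
      by (simp add: sum_divide_distrib)
    then show ?thesis
      using \<open>0 < U\<close> \<open>0 < V\<close> by (simp add: U_def V_def)
  qed
qed

section \<open>Power means: evaluation, homogeneity and duality\<close>

lemma power_mean_MInf: "power_mean (-\<infinity>) J w y = Min (y ` J)"
  by (simp add: power_mean_def flip: MInfty_eq_minfinity)

lemma power_mean_real:
  "power_mean (ereal r) J w y =
    (if r = 0 then \<Prod>i\<in>J. y i powr w i
     else if r < 0 \<and> (\<exists>i\<in>J. y i = 0) then 0
     else (\<Sum>i\<in>J. w i * y i powr r) powr (1 / r))"
  by (simp add: power_mean_def)

lemma dual_exponent_real: "r < 1 \<Longrightarrow> dual_exponent (ereal r) = ereal (r / (r - 1))"
  by (simp add: dual_exponent_def one_ereal_def)

lemma power_mean_cong: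
  assumes "\<And>i. i \<in> J \<Longrightarrow> y i = z i"
  shows "power_mean p J w y = power_mean p J w z"
proof -
  have "y ` J = z ` J" "(\<exists>i\<in>J. y i = 0) \<longleftrightarrow> (\<exists>i\<in>J. z i = 0)"
    "(\<Prod>i\<in>J. y i powr w i) = (\<Prod>i\<in>J. z i powr w i)"
    "(\<Sum>i\<in>J. w i * y i powr r) = (\<Sum>i\<in>J. w i * z i powr r)" for r
    using assms by (auto intro!: sum.cong prod.cong)
  then show ?thesis
    by (auto simp: power_mean_def split: ereal.split)
qed

lemma ereal_less_one_cases:
  assumes "(p::ereal) < 1"
  obtains "p = -\<infinity>" | r where "p = ereal r" "r < 1"
  using assms by (cases p) auto

context
  fixes J :: "'i set" and w :: "'i \<Rightarrow> real"
  assumes fin: "finite J" and w_pos: "\<And>i. i \<in> J \<Longrightarrow> 0 < w i" and w_sum: "sum w J = 1"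
begin

lemma index_nonempty: "J \<noteq> {}"
  using w_sum by auto

lemma weighted_sum_pos:
  assumes "\<And>i. i \<in> J \<Longrightarrow> 0 < z i"
  shows "0 < (\<Sum>i\<in>J. w i * z i)"
  using assms fin index_nonempty w_pos by (intro sum_pos) auto

lemma power_mean_pos:
  assumes "p < 1" "\<And>i. i \<in> J \<Longrightarrow> 0 < y i"
  shows "0 < power_mean p J w y"
  using \<open>p < 1\<close>
proof (cases rule: ereal_less_one_cases)
  case 1
  then show ?thesis
    using assms fin index_nonempty by (simp add: power_mean_MInf)
next
  case (2 r)
  have "0 < (\<Prod>i\<in>J. y i powr w i)"
    using assms by (intro prod_pos) force
  moreover have "0 < (\<Sum>i\<in>J. w i * y i powr r)"
    using assms by (intro weighted_sum_pos) force
  moreover have "\<not> (\<exists>i\<in>J. y i = 0)"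
    using assms by force
  ultimately show ?thesis
    by (simp add: 2 power_mean_real)
qed

text \<open>For \<open>r = 0\<close> the factor comes out as \<open>c\<close> itself because the
  weights sum to 1. Real exponents suffice, since scaling is applied to dual means and the dual
  exponent of any \<open>p < 1\<close> is real.\<close>

lemma power_mean_scale:
  assumes "0 < c"
  shows "power_mean (ereal r) J w (\<lambda>i. c * y i) = c * power_mean (ereal r) J w y"
proof -
  have "(\<Prod>i\<in>J. (c * y i) powr w i) = c * (\<Prod>i\<in>J. y i powr w i)"
    using powr_sum[of c w J] assms w_sum by (simp add: powr_mult prod.distrib)
  moreover have "(\<Sum>i\<in>J. w i * (c * y i) powr r) powr (1 / r) = c * (\<Sum>i\<in>J. w i * y i powr r) powr (1 / r)"
    if "r \<noteq> 0"
  proof -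
    have "(\<Sum>i\<in>J. w i * (c * y i) powr r) = c powr r * (\<Sum>i\<in>J. w i * y i powr r)"
      by (simp add: powr_mult sum_distrib_left mult.left_commute)
    then show ?thesis
      using that assms by (simp add: powr_mult powr_powr)
  qed
  ultimately show ?thesis
    using assms by (auto simp: power_mean_real)
qed

text \<open>Reverse Hoelder inequality. For \<open>p = -\<infinity>\<close> the numbers
  \<open>w i * \<alpha> i\<close> are convex weights, so they average to at least the minimum. For
  \<open>r = 0\<close> it is the AM-GM inequality for \<open>\<alpha> i * y i\<close>. Otherwise it
  is \<open>weighted_Holder\<close> with \<open>u i = \<alpha> i * y i\<close>: for
  \<open>0 < r\<close> with exponent \<open>r\<close> and \<open>v i = \<alpha> i powr q\<close>,
  for \<open>r < 0\<close> with exponent \<open>q\<close> and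
  \<open>v i = y i powr r\<close>.\<close>

lemma power_mean_le_multiplier:
  assumes "p < 1" and \<alpha>: "\<alpha> \<in> multiplier_set p J w" and y: "\<And>i. i \<in> J \<Longrightarrow> 0 \<le> y i"
  shows "power_mean p J w y \<le> (\<Sum>i\<in>J. \<alpha> i * w i * y i)"
  using \<open>p < 1\<close>
proof (cases rule: ereal_less_one_cases)
  case 1
  have \<alpha>0: "\<And>i. i \<in> J \<Longrightarrow> 0 \<le> \<alpha> i" and mean: "power_mean (ereal 1) J w \<alpha> = 1"
    using \<alpha> unfolding 1 by (auto simp: multiplier_set_def dual_exponent_def one_ereal_def)
  have "(\<Sum>i\<in>J. w i * \<alpha> i) = 1"
    using mean \<alpha>0 w_pos by (simp add: power_mean_real sum_nonneg less_imp_le)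
  then have "Min (y ` J) = (\<Sum>i\<in>J. w i * \<alpha> i * Min (y ` J))"
    by (simp flip: sum_distrib_right)
  also have "\<dots> \<le> (\<Sum>i\<in>J. w i * \<alpha> i * y i)"
    using fin w_pos \<alpha>0 by (intro sum_mono mult_left_mono) (auto simp: less_imp_le)
  finally show ?thesis
    by (simp add: 1 power_mean_MInf mult.commute)
next
  case (2 r)
  define q where "q = r / (r - 1)"
  have \<alpha>0: "\<And>i. i \<in> J \<Longrightarrow> if r < 0 then 0 \<le> \<alpha> i else 0 < \<alpha> i"
    and mean: "power_mean (ereal q) J w \<alpha> = 1"
    using \<alpha> unfolding 2 multiplier_set_def dual_exponent_real[OF \<open>r < 1\<close>] q_def
    by (auto split: if_splits)
  have \<alpha>_nonneg: "0 \<le> \<alpha> i" if "i \<in> J" for i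
    using \<alpha>0[OF that] by (auto split: if_splits)
  define S where "S = (\<Sum>i\<in>J. w i * (\<alpha> i * y i))"
  have S: "(\<Sum>i\<in>J. \<alpha> i * w i * y i) = S"
    unfolding S_def by (intro sum.cong) auto
  have "0 \<le> S"
    unfolding S_def using w_pos \<alpha>_nonneg y by (auto intro!: sum_nonneg simp: less_imp_le)
  \<comment> \<open>For \<open>r < 0\<close> a vanishing \<open>y i\<close> makes the mean 0 by
    convention, and \<open>0 \<le> S\<close> is enough; in the last case all entries are positive,
    so negative powers can be cancelled.\<close>
  consider "r = 0" | "0 < r" | "r < 0" "\<exists>i\<in>J. y i = 0" | "r < 0" "\<And>i. i \<in> J \<Longrightarrow> 0 < y i"
    using y by (metis linorder_neqE_linordered_idom less_eq_real_def)
  then have "power_mean (ereal r) J w y \<le> S"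
  proof cases
    case 1
    have "(\<Prod>i\<in>J. \<alpha> i powr w i) = 1"
      using mean 1 by (simp add: q_def power_mean_real)
    then have "(\<Prod>i\<in>J. y i powr w i) = (\<Prod>i\<in>J. (\<alpha> i * y i) powr w i)"
      by (simp add: powr_mult prod.distrib)
    also have "\<dots> \<le> S"
      unfolding S_def using fin w_pos w_sum \<alpha>_nonneg y
      by (intro weighted_arith_geom_mean) auto
    finally show ?thesis
      by (simp add: power_mean_real 1)
  next
    case 2
    have \<alpha>_pos: "\<And>i. i \<in> J \<Longrightarrow> 0 < \<alpha> i"
      using \<alpha>0 2 by auto
    have "q < 0"
      using 2 \<open>r < 1\<close> by (simp add: q_def divide_pos_neg)
    have "0 < (\<Sum>i\<in>J. w i * \<alpha> i powr q)"
      using \<alpha>_pos by (intro weighted_sum_pos) force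
    have root_one: "(\<Sum>i\<in>J. w i * \<alpha> i powr q) powr (1 / q) = 1"
      using mean \<open>q < 0\<close> \<alpha>_pos by (force simp: power_mean_real split: if_splits)
    have one: "(\<Sum>i\<in>J. w i * \<alpha> i powr q) = 1"
      using \<open>q < 0\<close> \<open>0 < (\<Sum>i\<in>J. w i * \<alpha> i powr q)\<close> by (intro powr_eq_one_imp[OF _ _ root_one]) auto
    \<comment> \<open>Thus \<open>(\<alpha> i powr q) powr (1 - r)\<close> is the inverse of
      \<open>\<alpha> i powr r\<close>, which removes \<alpha> from the product below.\<close>
    have qr: "q * (1 - r) = - r"
      using \<open>r < 1\<close> by (simp add: q_def field_simps)
    have "(\<Sum>i\<in>J. w i * y i powr r)
        = (\<Sum>i\<in>J. w i * ((\<alpha> i * y i) powr r * (\<alpha> i powr q) powr (1 - r)))"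
      using \<alpha>_pos by (intro sum.cong) (force simp: powr_mult powr_powr qr powr_minus field_simps)+
    also have "\<dots> \<le> S powr r * (\<Sum>i\<in>J. w i * \<alpha> i powr q) powr (1 - r)"
      unfolding S_def using fin w_pos y \<alpha>_nonneg 2 \<open>r < 1\<close>
      by (intro weighted_Holder) auto
    also have "\<dots> = S powr r"
      by (simp add: one)
    finally have "(\<Sum>i\<in>J. w i * y i powr r) powr (1 / r) \<le> (S powr r) powr (1 / r)"
      using 2 w_pos by (intro powr_mono2) (auto intro!: sum_nonneg simp: less_imp_le)
    then show ?thesis
      using 2 \<open>0 \<le> S\<close> by (simp add: power_mean_real powr_powr)
  next
    case 3
    then show ?thesis
      using \<open>0 \<le> S\<close> by (simp add: power_mean_real)
  next
    case 4
    have q: "0 < q" "q < 1"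
      using 4 \<open>r < 1\<close> by (auto simp: q_def field_simps)
    define T where "T = (\<Sum>i\<in>J. w i * y i powr r)"
    have "0 < T"
      unfolding T_def using 4 by (intro weighted_sum_pos) force
    have root_one: "(\<Sum>i\<in>J. w i * \<alpha> i powr q) powr (1 / q) = 1"
      using mean q by (simp add: power_mean_real)
    have one: "(\<Sum>i\<in>J. w i * \<alpha> i powr q) = 1"
      using q w_pos by (intro powr_eq_one_imp[OF _ _ root_one]) (auto intro!: sum_nonneg simp: less_imp_le)
    \<comment> \<open>The mirror image of the previous case: now the powers of \<open>y i\<close>
      cancel and \<open>\<alpha> i powr q\<close> remains.\<close>
    have qr: "r * (1 - q) = - q"
      using \<open>r < 1\<close> by (simp add: q_def field_simps)
    have "(\<Sum>i\<in>J. w i * \<alpha> i powr q)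
        = (\<Sum>i\<in>J. w i * ((\<alpha> i * y i) powr q * (y i powr r) powr (1 - q)))"
      using 4
      by (intro sum.cong) (force simp: powr_mult powr_powr qr powr_minus field_simps)+
    also have "\<dots> \<le> S powr q * T powr (1 - q)"
      unfolding S_def T_def using fin w_pos y \<alpha>_nonneg q
      by (intro weighted_Holder) auto
    \<comment> \<open>The left-hand sum is 1, so \<open>1 \<le> S powr q * T powr (1 - q)\<close>.
      Taking the power \<open>1 / q\<close> then produces the mean, because
      \<open>(q - 1) / q = 1 / r\<close>.\<close>
    finally have "T powr (q - 1) \<le> S powr q"
      using \<open>0 < T\<close> by (simp add: one powr_diff field_simps)
    then have "(T powr (q - 1)) powr (1 / q) \<le> (S powr q) powr (1 / q)"
      using q by (intro powr_mono2) auto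
    moreover have "(q - 1) * (1 / q) = 1 / r"
      using 4 \<open>r < 1\<close> by (simp add: q_def field_simps)
    ultimately have "T powr (1 / r) \<le> S"
      using q \<open>0 \<le> S\<close> by (simp add: powr_powr)
    then show ?thesis
      using 4 by (force simp: power_mean_real T_def)
  qed
  then show ?thesis
    by (simp add: 2 S)
qed

text \<open>Equality case of the reverse Hoelder inequality, at the not yet normalised multiplier
  \<open>y i powr (r - 1)\<close>. Both sides equal the sum \<open>T\<close> of
  \<open>w i * y i powr r\<close>: since \<open>(r - 1) * q = r\<close>, the two means are
  \<open>T powr (1 / r)\<close> and \<open>T powr ((r - 1) / r)\<close>. For \<open>r = 0\<close>
  both sides are 1.\<close>

lemma power_mean_dual_eq:
  assumes "r < 1" and y: "\<And>i. i \<in> J \<Longrightarrow> 0 < y i"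
  shows "power_mean (ereal r) J w y * power_mean (dual_exponent (ereal r)) J w (\<lambda>i. y i powr (r - 1))
      = (\<Sum>i\<in>J. y i powr (r - 1) * w i * y i)"
proof (cases "r = 0")
  case True
  have "(\<Prod>i\<in>J. y i powr w i) * (\<Prod>i\<in>J. (y i powr (- 1)) powr w i) = 1"
    unfolding prod.distrib[symmetric] powr_powr using y
    by (intro prod.neutral) (force simp flip: powr_add)
  moreover have "(\<Sum>i\<in>J. y i powr (- 1) * w i * y i) = sum w J"
    using y by (intro sum.cong) (force simp: powr_minus field_simps)+
  ultimately show ?thesis
    using w_sum by (simp add: True dual_exponent_real power_mean_real)
next
  case False
  define T where "T = (\<Sum>i\<in>J. w i * y i powr r)"
  have "0 < T"
    unfolding T_def using y by (intro weighted_sum_pos) force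
  have ne: "y i \<noteq> 0" if "i \<in> J" for i
    using y[OF that] by simp
  have "(\<Sum>i\<in>J. w i * (y i powr (r - 1)) powr (r / (r - 1))) = T"
    using \<open>r < 1\<close> by (simp add: powr_powr T_def)
  then have "power_mean (dual_exponent (ereal r)) J w (\<lambda>i. y i powr (r - 1)) = T powr (1 / (r / (r - 1)))"
    using False \<open>r < 1\<close> ne by (auto simp: dual_exponent_real power_mean_real)
  moreover have "power_mean (ereal r) J w y = T powr (1 / r)"
    using False ne by (auto simp: power_mean_real T_def)
  moreover have "T powr (1 / r) * T powr (1 / (r / (r - 1))) = T"
  proof -
    have "1 / r + 1 / (r / (r - 1)) = 1"
      using False \<open>r < 1\<close> by (simp add: field_simps)
    then show ?thesis
      using \<open>0 < T\<close> by (simp flip: powr_add)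
  qed
  moreover have "(\<Sum>i\<in>J. y i powr (r - 1) * w i * y i) = T"
    unfolding T_def using y by (intro sum.cong) (force simp: powr_diff field_simps)+
  ultimately show ?thesis
    by simp
qed

lemma dual_exponent_less_one:
  assumes "r < 1"
  obtains q where "dual_exponent (ereal r) = ereal q" "q < 1"
  using assms by (intro that[of "r / (r - 1)"]) (simp_all add: dual_exponent_real divide_less_eq)

text \<open>For \<open>p = -\<infinity>\<close> all mass goes to an index where the minimum is
  attained; for real \<open>r\<close> the multiplier of \<open>power_mean_dual_eq\<close> is divided
  by its dual mean.\<close>

lemma multiplier_attaining_power_mean:
  assumes "p < 1" and y: "\<And>i. i \<in> J \<Longrightarrow> 0 < y i"
  shows "\<exists>\<alpha>\<in>multiplier_set p J w. (\<Sum>i\<in>J. \<alpha> i * w i * y i) = power_mean p J w y"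
  using \<open>p < 1\<close>
proof (cases rule: ereal_less_one_cases)
  case 1
  have "Min (y ` J) \<in> y ` J"
    using fin index_nonempty by (intro Min_in) auto
  then obtain j where j: "j \<in> J" "y j = Min (y ` J)"
    by (elim imageE) (rule that, simp_all)
  \<comment> \<open>The value \<open>1 / w i\<close> gives \<open>\<alpha> j * w j = 1\<close>, so
    the weighted sum picks out the entry at \<open>j\<close>.\<close>
  define \<alpha> where "\<alpha> i = (if i = j then 1 / w i else 0)" for i
  have \<alpha>_sum: "(\<Sum>i\<in>J. \<alpha> i * w i * z i) = z j" for z
  proof -
    have "(\<Sum>i\<in>J. \<alpha> i * w i * z i) = (\<Sum>i\<in>J. if i = j then z i else 0)"
      using w_pos by (intro sum.cong) (force simp: \<alpha>_def)+
    then show ?thesis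
      using fin j by simp
  qed
  have nonneg: "0 \<le> \<alpha> i" if "i \<in> J" for i
    using w_pos[OF that] by (auto simp: \<alpha>_def)
  have "(\<Sum>i\<in>J. w i * \<alpha> i) = 1"
    using \<alpha>_sum[of "\<lambda>_. 1"] by (simp add: mult.commute)
  then have "(\<Sum>i\<in>J. w i * \<alpha> i powr 1) = 1"
    using nonneg by simp
  then have "\<alpha> \<in> multiplier_set p J w"
    using nonneg power_mean_real[of 1 J w \<alpha>]
    by (auto simp: 1 multiplier_set_def dual_exponent_def one_ereal_def)
  then show ?thesis
    using \<alpha>_sum j by (intro bexI[of _ \<alpha>]) (auto simp: 1 power_mean_MInf)
next
  case (2 r)
  obtain q where q: "dual_exponent (ereal r) = ereal q" "q < 1"
    using dual_exponent_less_one \<open>r < 1\<close> by blast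
  define M where "M = power_mean (ereal q) J w (\<lambda>i. y i powr (r - 1))"
  define \<alpha> where "\<alpha> i = inverse M * y i powr (r - 1)" for i
  have "0 < M"
    unfolding M_def using y q by (intro power_mean_pos) (force simp: one_ereal_def)+
  then have "power_mean (ereal q) J w \<alpha> = 1"
    using power_mean_scale[of "inverse M" q "\<lambda>i. y i powr (r - 1)"]
    by (simp add: \<alpha>_def[abs_def] flip: M_def)
  moreover have "0 < \<alpha> i" if "i \<in> J" for i
    using \<open>0 < M\<close> y[OF that] by (simp add: \<alpha>_def)
  ultimately have "\<alpha> \<in> multiplier_set p J w"
    using q by (auto simp: 2 multiplier_set_def less_imp_le)
  moreover have "(\<Sum>i\<in>J. \<alpha> i * w i * y i) = inverse M * (\<Sum>i\<in>J. y i powr (r - 1) * w i * y i)"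
    by (simp add: \<alpha>_def sum_distrib_left mult.assoc)
  moreover have "(\<Sum>i\<in>J. y i powr (r - 1) * w i * y i) = power_mean p J w y * M"
    using power_mean_dual_eq[of r y] y \<open>r < 1\<close> by (simp add: 2 q flip: M_def)
  ultimately show ?thesis
    using \<open>0 < M\<close> by (intro bexI[of _ \<alpha>]) simp_all
qed

text \<open>Test the support inequality at the \<open>y\<close> whose equality-case multiplier is
  \<beta>. There the sum with \<beta> factors as the mean of \<open>y\<close> times the dual mean of
  \<beta>, and the positive mean of \<open>y\<close> cancels. The majorant \<beta> is used because
  \<alpha> may have zeros, where such a \<open>y\<close> does not exist.\<close>

lemma dual_power_mean_ge_one:
  assumes "p < 1"
    and supp: "\<And>y. (\<And>i. i \<in> J \<Longrightarrow> 0 < y i) \<Longrightarrow> power_mean p J w y \<le> (\<Sum>i\<in>J. \<alpha> i * w i * y i)"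
    and \<beta>: "\<And>i. i \<in> J \<Longrightarrow> 0 < \<beta> i" "\<And>i. i \<in> J \<Longrightarrow> \<alpha> i \<le> \<beta> i"
  shows "1 \<le> power_mean (dual_exponent p) J w \<beta>"
  using \<open>p < 1\<close>
proof (cases rule: ereal_less_one_cases)
  case 1
  \<comment> \<open>For the minimum, the constant vector 1 is the test vector.\<close>
  have "1 \<le> (\<Sum>i\<in>J. \<alpha> i * w i)"
    using supp[of "\<lambda>_. 1"] index_nonempty by (simp add: 1 power_mean_MInf image_constant_conv)
  also have "\<dots> \<le> (\<Sum>i\<in>J. w i * \<beta> i)"
    using w_pos \<beta> by (intro sum_mono) (simp add: mult.commute)
  also have "\<dots> = (\<Sum>i\<in>J. w i * \<beta> i powr 1)"
    using \<beta> by (intro sum.cong) (auto simp: less_imp_le)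
  also have "\<dots> = power_mean (ereal 1) J w \<beta>"
    using w_pos by (simp add: power_mean_real sum_nonneg less_imp_le)
  finally show ?thesis
    by (simp add: 1 dual_exponent_def one_ereal_def)
next
  case (2 r)
  define y where "y i = \<beta> i powr (1 / (r - 1))" for i
  have y_pos: "0 < y i" if "i \<in> J" for i
    using \<beta>(1)[OF that] by (simp add: y_def)
  have y_\<beta>: "y i powr (r - 1) = \<beta> i" if "i \<in> J" for i
    using \<beta>(1)[OF that] \<open>r < 1\<close> by (simp add: y_def powr_powr)
  have "power_mean p J w y \<le> (\<Sum>i\<in>J. \<alpha> i * w i * y i)"
    using y_pos by (rule supp)
  also have "\<dots> \<le> (\<Sum>i\<in>J. \<beta> i * w i * y i)"
    using w_pos y_pos \<beta> by (intro sum_mono mult_right_mono) (auto simp: less_imp_le)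
  also have "\<dots> = (\<Sum>i\<in>J. y i powr (r - 1) * w i * y i)"
    using y_\<beta> by (intro sum.cong) auto
  also have "\<dots> = power_mean p J w y * power_mean (dual_exponent p) J w (\<lambda>i. y i powr (r - 1))"
    unfolding 2 using \<open>r < 1\<close> y_pos by (rule power_mean_dual_eq[symmetric])
  also have "\<dots> = power_mean p J w y * power_mean (dual_exponent p) J w \<beta>"
    using power_mean_cong[of J "\<lambda>i. y i powr (r - 1)" \<beta>] y_\<beta> by auto
  finally show ?thesis
    using power_mean_pos[OF \<open>p < 1\<close>, of y] y_pos by simp
qed

text \<open>The dual mean of \<alpha> turns out to be at least 1; taking it as \<open>c\<close> and
  dividing by it normalises \<alpha> by homogeneity.\<close>

lemma supporting_multiplier:
  assumes "p < 1" and \<alpha>_nonneg: "\<And>i. i \<in> J \<Longrightarrow> 0 \<le> \<alpha> i"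
    and supp: "\<And>y. (\<And>i. i \<in> J \<Longrightarrow> 0 < y i) \<Longrightarrow> power_mean p J w y \<le> (\<Sum>i\<in>J. \<alpha> i * w i * y i)"
  shows "\<exists>c\<ge>1. (\<lambda>i. inverse c * \<alpha> i) \<in> multiplier_set p J w"
proof -
  obtain q where q: "dual_exponent p = ereal q"
    and q_pos: "p < 0 \<Longrightarrow> 0 < q" and q_zero: "p = 0 \<Longrightarrow> q = 0" and q_neg: "0 < p \<Longrightarrow> q < 0"
    using \<open>p < 1\<close>
  proof (cases rule: ereal_less_one_cases)
    case 1
    then show ?thesis
      using that[of 1] by (simp add: dual_exponent_def one_ereal_def)
  next
    case (2 r)
    then show ?thesis
      using that[of "r / (r - 1)"] by (auto simp: dual_exponent_real divide_pos_neg divide_neg_neg)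
  qed
  \<comment> \<open>shifting by \<open>e > 0\<close> keeps negative powers away from the junk value \<open>0 powr q = 0\<close>;
    letting \<open>e\<close> tend to 0 comes last, since \<open>0 \<le> p\<close> first needs \<open>\<alpha> > 0\<close>\<close>
  have ge: "1 \<le> power_mean (ereal q) J w (\<lambda>i. \<alpha> i + e)" if "0 < e" for e
    unfolding q[symmetric] using \<open>p < 1\<close> supp \<alpha>_nonneg that
    by (intro dual_power_mean_ge_one[where \<alpha> = \<alpha>]) (auto intro: add_nonneg_pos)
  have shift_pos: "0 < \<alpha> i + e" if "i \<in> J" "0 < e" for i e
    using \<alpha>_nonneg that by (simp add: add_nonneg_pos)
  have shift: "((\<lambda>e. \<alpha> i + e) \<longlongrightarrow> \<alpha> i) (at_right 0)" for i
    by (auto intro!: tendsto_eq_intros)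
  have ev_pos: "\<forall>\<^sub>F e in at_right (0::real). 0 < e"
    by (simp add: eventually_at_filter)
  \<comment> \<open>The geometric case comes first because positivity of \<alpha> for
    \<open>p = 0\<close> is read off from it. The limit is valid even at zero entries, as the
    exponents \<open>w i\<close> are positive.\<close>
  have prod_case: "1 \<le> power_mean (ereal q) J w \<alpha>" if "q = 0"
  proof -
    have "((\<lambda>e. \<Prod>i\<in>J. (\<alpha> i + e) powr w i) \<longlongrightarrow> (\<Prod>i\<in>J. \<alpha> i powr w i)) (at_right 0)"
    proof (intro tendsto_prod tendsto_powr2 shift tendsto_const w_pos)
      show "\<forall>\<^sub>F e in at_right 0. 0 \<le> \<alpha> i + e" if "i \<in> J" for i
        using ev_pos by eventually_elim (use shift_pos[OF that] in \<open>auto simp: less_imp_le\<close>)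
    qed
    moreover have "\<forall>\<^sub>F e in at_right 0. 1 \<le> (\<Prod>i\<in>J. (\<alpha> i + e) powr w i)"
      using ev_pos by eventually_elim (use ge that in \<open>simp add: power_mean_real\<close>)
    ultimately show ?thesis
      using tendsto_lowerbound that by (fastforce simp: power_mean_real)
  qed
  have pos: "0 < \<alpha> i" if "i \<in> J" "0 \<le> p" for i
  proof (rule ccontr)
    assume "\<not> 0 < \<alpha> i"
    then have "\<alpha> i = 0"
      using \<alpha>_nonneg[OF \<open>i \<in> J\<close>] by simp
    show False
    proof (cases "p = 0")
      case True
      then have "q = 0"
        using q_zero by simp
      moreover have "(\<Prod>j\<in>J. \<alpha> j powr w j) = 0"
        using fin \<open>i \<in> J\<close> \<open>\<alpha> i = 0\<close> by (auto simp: prod_zero_iff)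
      ultimately show False
        using prod_case by (simp add: power_mean_real)
    next
      case False
      then have "q < 0"
        using q_neg \<open>0 \<le> p\<close> by simp
      \<comment> \<open>Chosen so that \<open>w i * e powr q = 2\<close>: if
        \<open>\<alpha> i = 0\<close>, this single summand already contradicts
        \<open>T \<le> 1\<close>.\<close>
      define e where "e = (2 / w i) powr (1 / q)"
      have "0 < w i"
        using w_pos \<open>i \<in> J\<close> .
      then have "0 < e"
        by (simp add: e_def)
      define T where "T = (\<Sum>j\<in>J. w j * (\<alpha> j + e) powr q)"
      have "0 < T"
        unfolding T_def using shift_pos \<open>0 < e\<close> by (intro weighted_sum_pos) force
      have "1 \<le> T powr (1 / q)"
        using ge[OF \<open>0 < e\<close>] \<open>q < 0\<close> by (auto simp: power_mean_real T_def split: if_splits)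
      then have "T \<le> 1"
        using powr_less_mono2_neg[of "1 / q" 1 T] \<open>q < 0\<close> by force
      moreover have "w i * (\<alpha> i + e) powr q \<le> T"
        unfolding T_def using fin \<open>i \<in> J\<close> w_pos
        by (intro member_le_sum) (auto simp: less_imp_le)
      moreover have "w i * (\<alpha> i + e) powr q = 2"
        using \<open>0 < w i\<close> \<open>q < 0\<close> by (simp add: \<open>\<alpha> i = 0\<close> e_def powr_powr)
      ultimately show False
        by simp
    qed
  qed
  have one_le: "1 \<le> power_mean (ereal q) J w \<alpha>"
  proof (cases "q = 0")
    case False
    \<comment> \<open>If \<open>q < 0\<close> then \<open>0 \<le> p\<close>, so \<alpha> is positive
      and the zero convention of the mean does not apply.\<close>
    have ne: "\<not> (q < 0 \<and> (\<exists>i\<in>J. \<alpha> i = 0))"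
      using pos q_pos by (metis less_irrefl less_asym not_le_imp_less)
    have powr_lim: "((\<lambda>e. (\<alpha> i + e) powr q) \<longlongrightarrow> \<alpha> i powr q) (at_right 0)" if "i \<in> J" for i
    proof (intro tendsto_powr' shift tendsto_const)
      have "\<forall>\<^sub>F e in at_right 0. 0 \<le> \<alpha> i + e"
        using ev_pos by eventually_elim (use shift_pos[OF that] in \<open>auto simp: less_imp_le\<close>)
      then show "\<alpha> i \<noteq> 0 \<or> 0 < q \<and> (\<forall>\<^sub>F e in at_right 0. 0 \<le> \<alpha> i + e)"
        using ne False that by (meson linorder_neqE_linordered_idom)
    qed
    have sum_lim: "((\<lambda>e. \<Sum>i\<in>J. w i * (\<alpha> i + e) powr q) \<longlongrightarrow> (\<Sum>i\<in>J. w i * \<alpha> i powr q)) (at_right 0)"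
      by (intro tendsto_intros powr_lim)
    have "((\<lambda>e. (\<Sum>i\<in>J. w i * (\<alpha> i + e) powr q) powr (1 / q)) \<longlongrightarrow> (\<Sum>i\<in>J. w i * \<alpha> i powr q) powr (1 / q)) (at_right 0)"
    proof (intro tendsto_powr' sum_lim tendsto_const)
      have "0 < (\<Sum>i\<in>J. w i * \<alpha> i powr q)" if "q < 0"
        using ne that by (intro weighted_sum_pos) force
      moreover have "\<forall>\<^sub>F e in at_right 0. 0 \<le> (\<Sum>i\<in>J. w i * (\<alpha> i + e) powr q)"
        using w_pos by (auto intro!: always_eventually sum_nonneg simp: less_imp_le)
      ultimately show "(\<Sum>i\<in>J. w i * \<alpha> i powr q) \<noteq> 0
          \<or> 0 < 1 / q \<and> (\<forall>\<^sub>F e in at_right 0. 0 \<le> (\<Sum>i\<in>J. w i * (\<alpha> i + e) powr q))"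
        using False by (cases "q < 0") auto
    qed
    moreover have "\<forall>\<^sub>F e in at_right 0. 1 \<le> (\<Sum>i\<in>J. w i * (\<alpha> i + e) powr q) powr (1 / q)"
      using ev_pos
      by eventually_elim (use ge False in \<open>force simp: power_mean_real split: if_splits\<close>)
    ultimately have "1 \<le> (\<Sum>i\<in>J. w i * \<alpha> i powr q) powr (1 / q)"
      using tendsto_lowerbound by fastforce
    then show ?thesis
      using ne False by (auto simp: power_mean_real)
  qed (rule prod_case)
  define c where "c = power_mean (ereal q) J w \<alpha>"
  have "1 \<le> c"
    using one_le by (simp add: c_def)
  moreover have "power_mean (ereal q) J w (\<lambda>i. inverse c * \<alpha> i) = 1"
    using power_mean_scale[of "inverse c" q \<alpha>] \<open>1 \<le> c\<close> by (simp flip: c_def)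
  ultimately show ?thesis
    using \<alpha>_nonneg pos q
    by (intro exI[of _ c]) (auto simp: multiplier_set_def)
qed

text \<open>The mean is a minimum of linear functions on positive vectors: the multiplier attaining
  it at the convex combination bounds the means of \<open>y\<close> and \<open>z\<close> from
  above.\<close>

lemma power_mean_concave:
  assumes "p < 1" and y: "\<And>i. i \<in> J \<Longrightarrow> 0 < y i" and z: "\<And>i. i \<in> J \<Longrightarrow> 0 < z i"
    and uv: "0 \<le> u" "0 \<le> v" "u + v = 1"
  shows "u * power_mean p J w y + v * power_mean p J w z \<le> power_mean p J w (\<lambda>i. u * y i + v * z i)"
proof -
  have pos: "0 < u * y i + v * z i" if "i \<in> J" for i
    using y[OF that] z[OF that] uv
    by (metis add.commute add_nonneg_pos add_pos_nonneg less_eq_real_def mult_pos_pos mult_zero_left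
        zero_less_one)
  obtain \<alpha> where \<alpha>: "\<alpha> \<in> multiplier_set p J w"
    "(\<Sum>i\<in>J. \<alpha> i * w i * (u * y i + v * z i)) = power_mean p J w (\<lambda>i. u * y i + v * z i)"
    using multiplier_attaining_power_mean[of p "\<lambda>i. u * y i + v * z i"] \<open>p < 1\<close> pos by blast
  have "u * power_mean p J w y + v * power_mean p J w z
      \<le> u * (\<Sum>i\<in>J. \<alpha> i * w i * y i) + v * (\<Sum>i\<in>J. \<alpha> i * w i * z i)"
    using \<open>p < 1\<close> \<alpha>(1) y z uv
    by (intro add_mono mult_left_mono power_mean_le_multiplier) (auto simp: less_imp_le)
  also have "\<dots> = (\<Sum>i\<in>J. \<alpha> i * w i * (u * y i + v * z i))"
    by (simp add: sum_distrib_left sum.distrib algebra_simps)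
  finally show ?thesis
    using \<alpha>(2) by simp
qed

end

section \<open>Quadratic forms and the lower envelope\<close>

lemma quad_form_zero [simp]: "quad_form M 0 = 0"
  by (simp add: quad_form_def)

lemma quad_form_add_scaleR:
  "quad_form M (x + t *\<^sub>R y) = quad_form M x + t * (x \<bullet> (M *v y) + y \<bullet> (M *v x)) + t\<^sup>2 * quad_form M y"
  by (simp add: quad_form_def matrix_vector_right_distrib matrix_vector_mult_scaleR inner_add_left
      inner_add_right power2_eq_square algebra_simps)

lemma quad_form_diff: "quad_form (M - N) x = quad_form M x - quad_form N x"
  by (simp add: quad_form_def matrix_vector_mult_diff_rdistrib inner_diff_right)

lemma quad_form_sum_scaleR:
  assumes "finite I"
  shows "quad_form (\<Sum>i\<in>I. c i *\<^sub>R A i) x = (\<Sum>i\<in>I. c i * quad_form (A i) x)"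
  using assms
  by induction (simp_all add: quad_form_def matrix_vector_mult_add_rdistrib inner_add_right
      flip: scaleR_matrix_vector_assoc)

lemma loewner_le_sum_iff:
  fixes A :: "'i::finite \<Rightarrow> real^'n^'n"
  assumes "\<And>i. psd (A i)" "psd B"
  shows "(\<Sum>i\<in>UNIV. c i *\<^sub>R A i) \<preceq> B \<longleftrightarrow> (\<forall>x. (\<Sum>i\<in>UNIV. c i * quad_form (A i) x) \<le> quad_form B x)"
proof -
  have sym: "A i $ j $ k = A i $ k $ j" "B $ j $ k = B $ k $ j" for i j k
    using assms by (auto simp: psd_def transpose_def vec_eq_iff)
  have "transpose (B - (\<Sum>i\<in>UNIV. c i *\<^sub>R A i)) = B - (\<Sum>i\<in>UNIV. c i *\<^sub>R A i)"
    by (simp add: vec_eq_iff transpose_def sym)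
  then show ?thesis
    by (simp add: loewner_le_def psd_def quad_form_diff quad_form_sum_scaleR)
qed

text \<open>Polarisation: if the form vanishes identically, so does its symmetric bilinear form, and
  then the matrix is 0.\<close>

lemma psd_nonzero_quad_form_pos:
  assumes "psd M" "M \<noteq> 0"
  shows "\<exists>x. 0 < quad_form M x"
proof (rule ccontr)
  assume "\<not> ?thesis"
  then have zero: "quad_form M x = 0" for x
    using \<open>psd M\<close> by (meson linorder_neqE_linordered_idom not_le psd_def)
  have "M *v y = 0" for y
  proof -
    have "x \<bullet> (M *v y) = y \<bullet> (M *v x)" for x
      using \<open>psd M\<close> dot_lmul_matrix[of x M y]
      by (metis inner_commute psd_def transpose_matrix_vector)
    then have "x \<bullet> (M *v y) = 0" for x
      using quad_form_add_scaleR[of M x 1 y] by (simp add: zero)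
    then show ?thesis
      using inner_eq_zero_iff by blast
  qed
  then show False
    using \<open>M \<noteq> 0\<close> by (simp add: matrix_eq)
qed

lemma eventually_quad_form_pos:
  assumes "0 < quad_form M x"
  shows "\<forall>\<^sub>F t in at_right 0. 0 < quad_form M (x + t *\<^sub>R y)"
proof -
  have "((\<lambda>t. quad_form M (x + t *\<^sub>R y)) \<longlongrightarrow> quad_form M x) (at_right 0)"
    unfolding quad_form_add_scaleR by (auto intro!: tendsto_eq_intros)
  then show ?thesis
    using assms order_tendstoD(1) by blast
qed

text \<open>Induction over the indices: forms already positive at \<open>x\<close> stay positive
  under a small move along \<open>y\<close> or \<open>- y\<close>, and one of these two moves makes
  the new form positive as well.\<close>

lemma common_quad_form_pos:
  assumes "finite J" "\<And>i. i \<in> J \<Longrightarrow> psd (A i)" "\<And>i. i \<in> J \<Longrightarrow> A i \<noteq> 0"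
  shows "\<exists>x. \<forall>i\<in>J. 0 < quad_form (A i) x"
  using assms
proof induction
  case (insert j J)
  then obtain x where x: "\<forall>i\<in>J. 0 < quad_form (A i) x"
    by auto
  obtain y where y: "0 < quad_form (A j) y"
    using insert.prems psd_nonzero_quad_form_pos by blast
  have "\<forall>\<^sub>F t in at_right (0::real). 0 < t"
    by (simp add: eventually_at_filter)
  moreover have "\<forall>\<^sub>F t in at_right 0. \<forall>i\<in>J. 0 < quad_form (A i) (x + t *\<^sub>R y)"
    using x \<open>finite J\<close> by (auto intro!: eventually_ball_finite eventually_quad_form_pos)
  moreover have "\<forall>\<^sub>F t in at_right 0. \<forall>i\<in>J. 0 < quad_form (A i) (x + t *\<^sub>R (- y))"
    using x \<open>finite J\<close> by (intro eventually_ball_finite ballI eventually_quad_form_pos) auto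
  ultimately have "\<forall>\<^sub>F t in at_right (0::real). 0 < t \<and> (\<forall>i\<in>J. 0 < quad_form (A i) (x + t *\<^sub>R y))
      \<and> (\<forall>i\<in>J. 0 < quad_form (A i) (x + t *\<^sub>R (- y)))"
    by (intro eventually_conj)
  then obtain t where t: "0 < t" "\<forall>i\<in>J. 0 < quad_form (A i) (x + t *\<^sub>R y)"
      "\<forall>i\<in>J. 0 < quad_form (A i) (x + t *\<^sub>R (- y))"
    using eventually_happens'[OF trivial_limit_at_right_real] by blast
  \<comment> \<open>parallelogram law: one of \<open>x \<plusminus> t y\<close> also makes the form of \<open>A j\<close> positive\<close>
  have "quad_form (A j) (x + t *\<^sub>R y) + quad_form (A j) (x + t *\<^sub>R (- y))
      = 2 * quad_form (A j) x + 2 * (t\<^sup>2 * quad_form (A j) y)"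
    using quad_form_add_scaleR[of "A j" x t y] quad_form_add_scaleR[of "A j" x "- t" y] by simp
  moreover have "0 \<le> quad_form (A j) x"
    using insert.prems by (simp add: psd_def)
  moreover have "0 < t\<^sup>2 * quad_form (A j) y"
    using \<open>0 < t\<close> y by simp
  ultimately have "0 < quad_form (A j) (x + t *\<^sub>R y) \<or> 0 < quad_form (A j) (x + t *\<^sub>R (- y))"
    by linarith
  then show ?case
    using t by blast
qed simp

section \<open>Separating a concave function from the lower envelope\<close>

lemma convex_epigraph_ereal:
  assumes "ereal_convex f"
  shows "convex {(a, t). f a \<le> ereal t}"
proof (rule convexI)
  fix x y :: "'a \<times> real" and u v :: real
  assume x: "x \<in> {(a, t). f a \<le> ereal t}" and y: "y \<in> {(a, t). f a \<le> ereal t}"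
    and uv: "0 \<le> u" "0 \<le> v" "u + v = 1"
  obtain a s b t where ab: "x = (a, s)" "y = (b, t)" "f a \<le> ereal s" "f b \<le> ereal t"
    using x y by auto
  show "u *\<^sub>R x + v *\<^sub>R y \<in> {(a, t). f a \<le> ereal t}"
  proof (cases "0 < v \<and> v < 1")
    case True
    have "u = 1 - v"
      using uv by simp
    have "f ((1 - v) *\<^sub>R a + v *\<^sub>R b) \<le> ereal (1 - v) * f a + ereal v * f b"
      using assms True by (simp add: ereal_convex_def)
    also have "\<dots> \<le> ereal (1 - v) * ereal s + ereal v * ereal t"
      using True ab by (intro add_mono ereal_mult_left_mono) auto
    finally show ?thesis
      by (simp add: ab \<open>u = 1 - v\<close>)
  next
    \<comment> \<open>\<open>ereal_convex\<close> speaks of \<open>0 < t < 1\<close> only; the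
      endpoints are trivial combinations.\<close>
    case False
    then have "u = 0 \<and> v = 1 \<or> u = 1 \<and> v = 0"
      using uv by auto
    then show ?thesis
      using x y by auto
  qed
qed

text \<open>A sandwich argument. The separating function is linear, not merely affine, because the
  epigraph contains the origin and, as \<open>F\<close> is nonnegative, the strict hypograph comes
  arbitrarily close to it, which forces the offset \<open>b\<close> to be 0.\<close>

lemma linear_between_concave_and_lower_envelope:
  fixes A :: "'i::finite \<Rightarrow> real^'n^'n" and F :: "real^'i \<Rightarrow> real"
  assumes conv: "ereal_convex (lower_envelope A B)"
    and A_psd: "\<And>i. psd (A i)" and A_nonzero: "\<And>i. A i \<noteq> 0"
    and concave: "concave_on {a. \<forall>i. 0 < a $ i} F"
    and nonneg: "\<And>a. (\<And>i. 0 < a $ i) \<Longrightarrow> 0 \<le> F a"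
    and le: "\<And>x. F (\<chi> i. quad_form (A i) x) \<le> quad_form B x"
  shows "\<exists>l. (\<forall>a. (\<forall>i. 0 < a $ i) \<longrightarrow> F a \<le> l \<bullet> a) \<and>
             (\<forall>x. l \<bullet> (\<chi> i. quad_form (A i) x) \<le> quad_form B x)"
proof -
  define S where "S = {(a, t). (\<forall>i. 0 < a $ i) \<and> t < F a}"
  define T where "T = {(a, t). lower_envelope A B a \<le> ereal t}"
  have T_mem: "((\<chi> i. quad_form (A i) x), t) \<in> T" if "quad_form B x \<le> t" for x t
    using that by (auto simp: T_def lower_envelope_def intro!: INF_lower2[of x])
  have zero_T: "(0, t) \<in> T" if "0 \<le> t" for t
    using T_mem[of 0 t] that by (simp flip: zero_vec_def)
  have "convex S"
  proof (rule convexI)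
    fix x y and u v :: real
    assume "x \<in> S" "y \<in> S" and uv: "0 \<le> u" "0 \<le> v" "u + v = 1"
    then obtain a s b t where ab: "x = (a, s)" "y = (b, t)" "\<forall>i. 0 < a $ i" "\<forall>i. 0 < b $ i"
      "s < F a" "t < F b"
      by (auto simp: S_def)
    have "u * F a + v * F b \<le> F (u *\<^sub>R a + v *\<^sub>R b)"
      using concave ab uv by (simp add: concave_on_iff)
    moreover have "u * s + v * t < u * F a + v * F b"
      using ab uv convex_bound_lt[of "s - F a" 0 "t - F b" u v] by (simp add: algebra_simps)
    moreover have "0 < u * a $ i + v * b $ i" for i
      using ab uv convex_bound_lt[of "- (a $ i)" 0 "- (b $ i)" u v] by simp
    ultimately show "u *\<^sub>R x + v *\<^sub>R y \<in> S"
      by (simp add: S_def ab)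
  qed
  moreover have "convex T"
    unfolding T_def using conv by (rule convex_epigraph_ereal)
  moreover have "(1, F 1 - 1) \<in> S"
    by (simp add: S_def)
  then have "S \<noteq> {}"
    by blast
  moreover have "T \<noteq> {}"
    using zero_T by blast
  moreover have "S \<inter> T = {}"
  proof -
    have False if "lower_envelope A B a \<le> ereal t" "t < F a" for a t
    proof -
      \<comment> \<open>The infimum need not be attained; being strictly below \<open>F a\<close> is
        what yields a feasible \<open>x\<close> with a value below \<open>F a\<close>.\<close>
      have "lower_envelope A B a < ereal (F a)"
        using that by (meson ereal_less_le less_ereal.simps(1) order_le_less_trans)
      then obtain x where "\<forall>i. quad_form (A i) x = a $ i" "quad_form B x < F a"
        by (auto simp: lower_envelope_def INF_less_iff)
      then show False
        using le[of x] by (simp add: vec_lambda_eta)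
    qed
    then show ?thesis
      by (auto simp: S_def T_def)
  qed
  ultimately obtain l \<mu> b where l\<mu>: "(l, \<mu>) \<noteq> 0"
    and S_sep: "\<forall>x\<in>S. (l, \<mu>) \<bullet> x \<le> b" and T_sep: "\<forall>x\<in>T. (l, \<mu>) \<bullet> x \<ge> b"
    using separating_hyperplane_sets[of S T] by auto
  have S_le: "l \<bullet> a + \<mu> * t \<le> b" if "\<And>i. 0 < a $ i" "t < F a" for a t
    using S_sep that by (force simp: S_def)
  have T_ge: "b \<le> l \<bullet> a + \<mu> * t" if "(a, t) \<in> T" for a t
    using T_sep that by force
  have "b \<le> 0"
    using T_ge[OF zero_T[of 0]] by simp
  \<comment> \<open>The points \<open>(e *\<^sub>R 1, - e)\<close> lie in \<open>S\<close> since
    \<open>F\<close> is nonnegative, and they tend to the origin.\<close>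
  moreover have "0 \<le> b"
  proof (rule le_if_le_add_mult)
    fix e :: real
    assume "0 < e"
    then show "0 \<le> b + e * (\<mu> - l \<bullet> 1)"
      using S_le[of "e *\<^sub>R 1" "- e"] nonneg[of "e *\<^sub>R 1"] by (simp add: algebra_simps)
  qed
  ultimately have "b = 0"
    by simp
  then have "0 \<le> \<mu>"
    using T_ge[OF zero_T[of 1]] by simp
  have S_le0: "l \<bullet> a + \<mu> * F a \<le> 0" if "\<And>i. 0 < a $ i" for a
  proof -
    have "0 \<le> - (l \<bullet> a + \<mu> * F a)"
    proof (rule le_if_le_add_mult)
      fix e :: real
      assume "0 < e"
      then show "0 \<le> - (l \<bullet> a + \<mu> * F a) + e * \<mu>"
        using S_le[of a "F a - e"] that by (simp add: \<open>b = 0\<close> algebra_simps)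
    qed
    then show ?thesis
      by simp
  qed
  have T_ge0: "0 \<le> l \<bullet> (\<chi> i. quad_form (A i) x) + \<mu> * quad_form B x" for x
    using T_ge[OF T_mem[of x "quad_form B x"]] by (simp add: \<open>b = 0\<close>)
  \<comment> \<open>If \<mu> were 0, \<open>l\<close> would be at most 0 on the open orthant but at
    least 0 at the vector \<open>a\<close> of form values of some \<open>x\<close>, which lies in
    that orthant. A short step from \<open>a\<close> in the direction \<open>l\<close> stays there
    and makes the inner product with \<open>l\<close> positive.\<close>
  have "\<mu> \<noteq> 0"
  proof
    assume "\<mu> = 0"
    then have "l \<noteq> 0"
      using l\<mu> by (simp add: zero_prod_def)
    obtain x where x: "\<forall>i. 0 < quad_form (A i) x"
      using common_quad_form_pos[of UNIV A] A_psd A_nonzero by auto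
    define a where "a = (\<chi> i. quad_form (A i) x)"
    have "\<forall>\<^sub>F e in at_right 0. 0 < a $ i + e * l $ i" for i
    proof -
      have "((\<lambda>e. a $ i + e * l $ i) \<longlongrightarrow> a $ i) (at_right 0)"
        by (auto intro!: tendsto_eq_intros)
      then show ?thesis
        using x order_tendstoD(1) by (fastforce simp: a_def)
    qed
    then have "\<forall>\<^sub>F e in at_right (0::real). 0 < e \<and> (\<forall>i. 0 < a $ i + e * l $ i)"
      by (intro eventually_conj eventually_all_finite) (simp_all add: eventually_at_filter)
    then obtain e where e: "0 < e" "\<And>i. 0 < a $ i + e * l $ i"
      using eventually_happens'[OF trivial_limit_at_right_real] by blast
    have "l \<bullet> (a + e *\<^sub>R l) \<le> 0"
      using S_le0[of "a + e *\<^sub>R l"] e by (simp add: \<open>\<mu> = 0\<close>)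
    moreover have "0 \<le> l \<bullet> a"
      using T_ge0[of x] by (simp add: \<open>\<mu> = 0\<close> a_def)
    moreover have "0 < e * (l \<bullet> l)"
      using e \<open>l \<noteq> 0\<close> by simp
    ultimately show False
      by (simp add: inner_add_right)
  qed
  then have "0 < \<mu>"
    using \<open>0 \<le> \<mu>\<close> by simp
  \<comment> \<open>Dividing by \<mu> and changing sign solves the hyperplane equation for its last
    coordinate.\<close>
  have "F a \<le> ((- inverse \<mu>) *\<^sub>R l) \<bullet> a" if "\<forall>i. 0 < a $ i" for a
    using S_le0[of a] that \<open>0 < \<mu>\<close> by (simp add: field_simps)
  moreover have "((- inverse \<mu>) *\<^sub>R l) \<bullet> (\<chi> i. quad_form (A i) x) \<le> quad_form B x" for x
    using T_ge0[of x] \<open>0 < \<mu>\<close> by (simp add: field_simps)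
  ultimately show ?thesis
    by blast
qed

section \<open>The equivalence\<close>

text \<open>Allows multipliers found separately on the groups to be glued into one function.\<close>

lemma multiplier_set_cong:
  assumes "\<And>i. i \<in> J \<Longrightarrow> \<alpha> i = \<beta> i"
  shows "\<alpha> \<in> multiplier_set p J w \<longleftrightarrow> \<beta> \<in> multiplier_set p J w"
  using assms power_mean_cong[of J \<alpha> \<beta>] by (simp add: multiplier_set_def)

theorem theorem4p1:
  fixes K :: nat
    and grp :: "nat \<Rightarrow> 'i::finite set"
    and p :: "nat \<Rightarrow> ereal"
    and w :: "'i \<Rightarrow> real"
    and A :: "'i \<Rightarrow> real^'n^'n"
    and B :: "real^'n^'n"
  assumes disjoint: "disjoint_family_on grp {1..K}"
    and cover: "(\<Union>k\<in>{1..K}. grp k) = UNIV"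
    and p_less: "\<And>k. k \<in> {1..K} \<Longrightarrow> p k < 1"
    and w_pos: "\<And>i. 0 < w i"
    and w_sum: "\<And>k. k \<in> {1..K} \<Longrightarrow> (\<Sum>i\<in>grp k. w i) = 1"
    and A_psd: "\<And>i. psd (A i)"
    and A_nonzero: "\<And>i. A i \<noteq> 0"
    and B_psd: "psd B"
  defines "stmt_i \<equiv>
      (\<forall>x. (\<Sum>k=1..K. power_mean (p k) (grp k) w (\<lambda>i. quad_form (A i) x)) \<le> quad_form B x)"
    and "stmt_ii \<equiv>
      (\<exists>\<alpha> \<in> (\<Inter>k\<in>{1..K}. multiplier_set (p k) (grp k) w).
         (\<Sum>i\<in>UNIV. (\<alpha> i * w i) *\<^sub>R A i) \<preceq> B)"
  shows "(stmt_ii \<longrightarrow> stmt_i) \<and>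
         (ereal_convex (lower_envelope A B) \<longrightarrow> (stmt_i \<longleftrightarrow> stmt_ii))"
proof -
  have ii_imp_i: stmt_i if stmt_ii
    unfolding stmt_i_def
  proof
    fix x
    obtain \<alpha> where \<alpha>: "\<And>k. k \<in> {1..K} \<Longrightarrow> \<alpha> \<in> multiplier_set (p k) (grp k) w"
      and le: "(\<Sum>i\<in>UNIV. (\<alpha> i * w i) *\<^sub>R A i) \<preceq> B"
      using \<open>stmt_ii\<close> unfolding stmt_ii_def by blast
    have "(\<Sum>k=1..K. power_mean (p k) (grp k) w (\<lambda>i. quad_form (A i) x))
        \<le> (\<Sum>k=1..K. \<Sum>i\<in>grp k. \<alpha> i * w i * quad_form (A i) x)"
      using \<alpha> p_less w_pos w_sum A_psd
      by (intro sum_mono power_mean_le_multiplier) (auto simp: psd_def)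
    also have "\<dots> = (\<Sum>i\<in>(\<Union>k\<in>{1..K}. grp k). \<alpha> i * w i * quad_form (A i) x)"
      using disjoint by (intro sum.UNION_disjoint_family[symmetric]) auto
    also have "\<dots> \<le> quad_form B x"
      using le unfolding cover loewner_le_sum_iff[OF A_psd B_psd] by blast
    finally show "(\<Sum>k=1..K. power_mean (p k) (grp k) w (\<lambda>i. quad_form (A i) x)) \<le> quad_form B x" .
  qed
  moreover have stmt_ii if conv: "ereal_convex (lower_envelope A B)" and stmt_i
  proof -
    define F :: "real^'i \<Rightarrow> real" where "F a = (\<Sum>k=1..K. power_mean (p k) (grp k) w (\<lambda>i. a $ i))" for a
    have mean_nonneg: "0 \<le> power_mean (p k) (grp k) w (\<lambda>i. a $ i)"
      if "k \<in> {1..K}" "\<And>i. 0 < a $ i" for k and a :: "real^'i"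
      using power_mean_pos[of "grp k" w "p k" "\<lambda>i. a $ i"] that w_pos w_sum p_less
      by (simp add: less_imp_le)
    have F_nonneg: "0 \<le> F a" if "\<And>i. 0 < a $ i" for a
      unfolding F_def using mean_nonneg that by (intro sum_nonneg) auto
    have "concave_on {a. \<forall>i. 0 < a $ i} F"
      unfolding concave_on_iff
    proof (intro conjI ballI allI impI)
      show "convex {a::real^'i. \<forall>i. 0 < a $ i}"
        by (rule convex_box_cart) (use convex_real_interval in \<open>simp add: greaterThan_def\<close>)
      fix a b :: "real^'i" and u v :: real
      assume "a \<in> {a. \<forall>i. 0 < a $ i}" "b \<in> {a. \<forall>i. 0 < a $ i}" "0 \<le> u" "0 \<le> v" "u + v = 1"
      then show "u * F a + v * F b \<le> F (u *\<^sub>R a + v *\<^sub>R b)"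
        unfolding F_def sum_distrib_left sum.distrib[symmetric] vector_add_component vector_scaleR_component
          real_scaleR_def
        using p_less w_pos w_sum by (intro sum_mono power_mean_concave) auto
    qed
    moreover have "F (\<chi> i. quad_form (A i) x) \<le> quad_form B x" for x
      using \<open>stmt_i\<close> by (simp add: stmt_i_def F_def)
    ultimately obtain l where F_le: "\<And>a. (\<forall>i. 0 < a $ i) \<Longrightarrow> F a \<le> l \<bullet> a"
      and l_le: "\<And>x. l \<bullet> (\<chi> i. quad_form (A i) x) \<le> quad_form B x"
      using linear_between_concave_and_lower_envelope[OF conv A_psd A_nonzero, of F] F_nonneg by blast
    \<comment> \<open>The axis vector lies on the boundary of the orthant, so it is shifted by
      \<open>e *\<^sub>R 1\<close>; there \<open>0 \<le> F\<close> and \<open>F\<close> is at most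
      the inner product with \<open>l\<close>.\<close>
    have l_nonneg: "0 \<le> l $ i" for i
    proof (rule le_if_le_add_mult)
      fix e :: real
      assume "0 < e"
      have pos: "0 < (axis i 1 + e *\<^sub>R 1 :: real^'i) $ j" for j
        using \<open>0 < e\<close> by (simp add: axis_def)
      have "0 \<le> l \<bullet> (axis i 1 + e *\<^sub>R 1)"
        using F_le[of "axis i 1 + e *\<^sub>R 1"] F_nonneg[of "axis i 1 + e *\<^sub>R 1"] pos by force
      then show "0 \<le> l $ i + e * (l \<bullet> 1)"
        by (simp add: inner_add_right inner_axis)
    qed
    \<comment> \<open>Divides out the weights, so that \<open>l\<close> has the coefficients
      \<open>\<alpha> i * w i\<close> of (ii).\<close>
    define \<alpha> where "\<alpha> i = l $ i / w i" for i
    have \<alpha>w: "\<alpha> i * w i = l $ i" for i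
      using w_pos[of i] by (simp add: \<alpha>_def)
    have \<alpha>_nonneg: "0 \<le> \<alpha> i" for i
      using l_nonneg w_pos by (simp add: \<alpha>_def less_imp_le)
    have supp: "power_mean (p k) (grp k) w y \<le> (\<Sum>i\<in>grp k. \<alpha> i * w i * y i)"
      if k: "k \<in> {1..K}" and y: "\<And>i. i \<in> grp k \<Longrightarrow> 0 < y i" for k y
    proof (rule le_if_le_add_mult)
      \<comment> \<open>extend \<open>y\<close> by \<open>e\<close> outside the group and let \<open>e\<close> tend to 0; the other means are nonnegative\<close>
      fix e :: real
      assume "0 < e"
      define a :: "real^'i" where "a = (\<chi> i. if i \<in> grp k then y i else e)"
      have a_pos: "0 < a $ i" for i
        using y \<open>0 < e\<close> by (simp add: a_def)
      have "power_mean (p k) (grp k) w y = power_mean (p k) (grp k) w (\<lambda>i. a $ i)"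
        by (rule power_mean_cong) (simp add: a_def)
      also have "\<dots> \<le> F a"
        unfolding F_def using k mean_nonneg a_pos by (intro member_le_sum) auto
      also have "\<dots> \<le> l \<bullet> a"
        using F_le a_pos by blast
      also have "\<dots> = (\<Sum>i\<in>UNIV. l $ i * a $ i)"
        by (simp add: inner_vec_def)
      also have "\<dots> = (\<Sum>i\<in>grp k. l $ i * a $ i) + (\<Sum>i\<in>- grp k. l $ i * a $ i)"
        by (simp add: sum.subset_diff[of "grp k" UNIV] Compl_eq_Diff_UNIV)
      also have "\<dots> = (\<Sum>i\<in>grp k. \<alpha> i * w i * y i) + e * (\<Sum>i\<in>- grp k. l $ i)"
        unfolding \<alpha>w sum_distrib_left
        by (intro arg_cong2[where f = "(+)"] sum.cong) (auto simp: a_def)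
      finally show "power_mean (p k) (grp k) w y
          \<le> (\<Sum>i\<in>grp k. \<alpha> i * w i * y i) + e * (\<Sum>i\<in>- grp k. l $ i)" .
    qed
    have "\<exists>c\<ge>1. (\<lambda>i. inverse c * \<alpha> i) \<in> multiplier_set (p k) (grp k) w" if "k \<in> {1..K}" for k
      using that p_less w_pos w_sum \<alpha>_nonneg supp by (intro supporting_multiplier) auto
    then obtain c where c: "\<And>k. k \<in> {1..K} \<Longrightarrow> 1 \<le> c k"
      "\<And>k. k \<in> {1..K} \<Longrightarrow> (\<lambda>i. inverse (c k) * \<alpha> i) \<in> multiplier_set (p k) (grp k) w"
      by metis
    have "\<exists>k\<in>{1..K}. i \<in> grp k" for i
      using cover by blast
    then obtain \<kappa> where \<kappa>: "\<And>i. \<kappa> i \<in> {1..K}" "\<And>i. i \<in> grp (\<kappa> i)"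
      by metis
    have \<kappa>_eq: "\<kappa> i = k" if "k \<in> {1..K}" "i \<in> grp k" for i k
      using disjoint_family_onD[OF disjoint \<kappa>(1)[of i] that(1)] \<kappa>(2)[of i] that(2) by blast
    \<comment> \<open>The scaling factor depends on the group; \<open>\<kappa> i\<close> is the
      unique group containing \<open>i\<close>, so on \<open>grp k\<close> this is \<alpha> divided
      by \<open>c k\<close>.\<close>
    define \<beta> where "\<beta> i = inverse (c (\<kappa> i)) * \<alpha> i" for i
    have "\<beta> \<in> multiplier_set (p k) (grp k) w" if "k \<in> {1..K}" for k
      using multiplier_set_cong[of "grp k" \<beta> "\<lambda>i. inverse (c k) * \<alpha> i"] c that
      by (simp add: \<beta>_def \<kappa>_eq)
    moreover have "(\<Sum>i\<in>UNIV. (\<beta> i * w i) *\<^sub>R A i) \<preceq> B"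
      unfolding loewner_le_sum_iff[OF A_psd B_psd]
    proof
      fix x
      \<comment> \<open>Scaling down by \<open>c \<ge> 1\<close> only lowers the left-hand side,
        because the weights and the forms are nonnegative.\<close>
      have "\<beta> i \<le> \<alpha> i" for i
        using c(1)[OF \<kappa>(1)] \<alpha>_nonneg mult_right_mono[of "inverse (c (\<kappa> i))" 1 "\<alpha> i"]
        by (simp add: \<beta>_def inverse_le_1_iff)
      then have "(\<Sum>i\<in>UNIV. \<beta> i * w i * quad_form (A i) x) \<le> (\<Sum>i\<in>UNIV. \<alpha> i * w i * quad_form (A i) x)"
        using w_pos A_psd by (intro sum_mono mult_right_mono) (auto simp: psd_def less_imp_le)
      also have "\<dots> = l \<bullet> (\<chi> i. quad_form (A i) x)"
        by (simp add: \<alpha>w inner_vec_def)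
      finally show "(\<Sum>i\<in>UNIV. \<beta> i * w i * quad_form (A i) x) \<le> quad_form B x"
        using l_le[of x] by simp
    qed
    ultimately show ?thesis
      unfolding stmt_ii_def by blast
  qed
  ultimately show ?thesis
    by blast
qed

end
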